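(* Let $G$ be a permutation group of degree $n$, let $1\le l\le n$ and let $d$ be the size of a smallest $G$-orbit. Then $G$ possesses the $(1,l)$-universal transversal property if and only if every $G$-orbit has size at least $n-l+1$. Equivalently, $t(G,1)=n-d+1$.
   Context: A permutation group of degree $n$ is a subgroup $G$ of the symmetric group on a finite set $\Omega$ with $|\Omega|=n$, acting on the right. A $k$-partition of a set is a partition into $k$ non-empty parts; a transversal for it is a set meeting each part in exactly one point. For $1\le k\le l\le n$, $G$ has the $(k,l)$-universal transversal property ($(k,l)$-ut) if for every $k$-subset $A$ of $\Omega$, every $l$-subset $B$ of $\Omega$ and every $k$-partition $P$ of $B$ there is $g\in G$ such that $Ag$ is a transversal for $P$. For a group $G$ with the $(k,n)$-ut property, $t(G,k)$ denotes the threshold integer such that, for $k\le l\le n$, $G$ has $(k,l)$-ut if and only if $l\ge t(G,k)$ (it exists because $(k,l)$-ut implies $(k,m)$-ut for $l\le m\le n$). Every permutation group has the $(1,n)$-ut property. Orbits are orbits of $G$ on $\Omega$. *)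

theory Defs
  imports "HOL-Algebra.Group_Action" "HOL-Library.Disjoint_Sets"
begin

text \<open>
  A permutation group on \<open>\<Omega>\<close> is a set \<open>G\<close> of permutations with \<open>subgroup G (BijGroup \<Omega>)\<close>; the image
  \<open>A g\<close> of a set \<open>A \<subseteq> \<Omega>\<close> under the action of \<open>g\<close> is \<open>g ` A\<close>. The product of \<^const>\<open>BijGroup\<close> composes
  from right to left, whereas for a right action one composes from left to right. Both products
  have the same subgroups, and neither images nor orbits depend on the choice.
\<close>

definition perm_orbits :: "'a set \<Rightarrow> ('a \<Rightarrow> 'a) set \<Rightarrow> 'a set set"
  where "perm_orbits \<Omega> G = orbits ((BijGroup \<Omega>)\<lparr>carrier := G\<rparr>) \<Omega> (\<lambda>g. g)"

definition k_partition :: "nat \<Rightarrow> 'a set \<Rightarrow> 'a set set \<Rightarrow> bool"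
  where "k_partition k B P \<longleftrightarrow> partition_on B P \<and> finite P \<and> card P = k"

definition transversal :: "'a set set \<Rightarrow> 'a set \<Rightarrow> bool"
  where "transversal P T \<longleftrightarrow> (\<forall>p\<in>P. \<exists>!x. x \<in> T \<inter> p)"

text \<open>The notion is meant for \<open>1 \<le> k \<le> l \<le> card \<Omega>\<close> and finite \<open>\<Omega>\<close>.\<close>

definition ut :: "'a set \<Rightarrow> ('a \<Rightarrow> 'a) set \<Rightarrow> nat \<Rightarrow> nat \<Rightarrow> bool"
  where "ut \<Omega> G k l \<longleftrightarrow>
    (\<forall>A B P. A \<subseteq> \<Omega> \<and> card A = k \<and> B \<subseteq> \<Omega> \<and> card B = l \<and> k_partition k B P \<longrightarrow>
      (\<exists>g\<in>G. transversal P (g ` A)))"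

text \<open>
  The bound \<open>k \<le> t\<close> makes the threshold unique: if the property holds for all \<open>l\<close> between \<open>k\<close>
  and \<open>card \<Omega>\<close>, then every integer \<open>t \<le> k\<close> would satisfy the equivalence.
\<close>

definition threshold :: "'a set \<Rightarrow> ('a \<Rightarrow> 'a) set \<Rightarrow> nat \<Rightarrow> nat"
  where "threshold \<Omega> G k =
    (THE t. k \<le> t \<and> t \<le> card \<Omega> \<and> (\<forall>l. k \<le> l \<and> l \<le> card \<Omega> \<longrightarrow> (ut \<Omega> G k l \<longleftrightarrow> t \<le> l)))"

end

theory Submission
  imports Defs
begin

text \<open>
  For \<open>k = 1\<close> the universal transversal property is a counting statement. The only \<open>1\<close>-partition of
  a nonempty set \<open>B\<close> is \<open>{B}\<close>, and the image of \<open>{a}\<close> is a transversal for it exactly when it lies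
  in \<open>B\<close>. Hence the \<open>(1,l)\<close>-property says that every \<open>l\<close>-subset of \<open>\<Omega>\<close> meets every orbit
  (lemma \<open>ut_1_iff_meets_orbits\<close>). An orbit \<open>X\<close> is avoided by some \<open>l\<close>-subset precisely if its
  complement, of size \<open>n - |X|\<close>, has at least \<open>l\<close> elements (lemma \<open>all_subsets_meet_iff\<close>), so the
  property holds if and only if \<open>n - |X| < l\<close> for all orbits. The binding orbit is a smallest one,
  of size \<open>d\<close>, which gives the condition \<open>n - d + 1 \<le> l\<close>. Since \<open>1 \<le> d \<le> n\<close>, this bound lies
  between \<open>1\<close> and \<open>n\<close>, and is therefore the threshold.
\<close>

lemma perm_orbits_eq: "perm_orbits \<Omega> G = (\<lambda>a. (\<lambda>g. g a) ` G) ` \<Omega>"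
  by (auto simp: perm_orbits_def orbits_def orbit_def)

lemma perm_group_maps:
  assumes "subgroup G (BijGroup \<Omega>)" "g \<in> G" "a \<in> \<Omega>"
  shows "g a \<in> \<Omega>"
proof -
  have "g \<in> Bij \<Omega>"
    using subgroup.subset[OF assms(1)] assms(2) by (auto simp: BijGroup_def)
  then show ?thesis
    using assms(3) by (auto simp: Bij_def bij_betw_def)
qed

lemma perm_orbit_subset:
  assumes "subgroup G (BijGroup \<Omega>)" "X \<in> perm_orbits \<Omega> G"
  shows "X \<subseteq> \<Omega>"
  using assms perm_group_maps[OF assms(1)] by (auto simp: perm_orbits_eq)

lemma perm_orbit_nonempty:
  assumes "subgroup G (BijGroup \<Omega>)" "X \<in> perm_orbits \<Omega> G"
  shows "X \<noteq> {}"
  using assms subgroup.one_closed[OF assms(1)] by (auto simp: perm_orbits_eq)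

lemma k_partition_1_iff: "k_partition 1 B P \<longleftrightarrow> B \<noteq> {} \<and> P = {B}"
proof
  assume "k_partition 1 B P"
  then have P: "partition_on B P" and "card P = 1"
    by (auto simp: k_partition_def)
  then obtain p where "P = {p}"
    by (auto simp: card_1_singleton_iff)
  then show "B \<noteq> {} \<and> P = {B}"
    using P by (auto simp: partition_on_def)
qed (auto simp: k_partition_def partition_on_def)

lemma transversal_singleton_iff: "transversal {B} (g ` {a}) \<longleftrightarrow> g a \<in> B"
  by (auto simp: transversal_def)

lemma ut_1_iff_meets_orbits:
  assumes "1 \<le> l"
  shows "ut \<Omega> G 1 l \<longleftrightarrow>
    (\<forall>X\<in>perm_orbits \<Omega> G. \<forall>B. B \<subseteq> \<Omega> \<and> card B = l \<longrightarrow> B \<inter> X \<noteq> {})"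
proof -
  have "ut \<Omega> G 1 l \<longleftrightarrow> (\<forall>a\<in>\<Omega>. \<forall>B. B \<subseteq> \<Omega> \<and> card B = l \<longrightarrow> (\<exists>g\<in>G. g a \<in> B))"
  proof
    assume ut: "ut \<Omega> G 1 l"
    show "\<forall>a\<in>\<Omega>. \<forall>B. B \<subseteq> \<Omega> \<and> card B = l \<longrightarrow> (\<exists>g\<in>G. g a \<in> B)"
    proof (intro ballI allI impI)
      fix a B assume a: "a \<in> \<Omega>" and B: "B \<subseteq> \<Omega> \<and> card B = l"
      \<comment> \<open>The condition \<open>l \<ge> 1\<close> enters here: the empty set has no \<open>1\<close>-partition.\<close>
      then have "k_partition 1 B {B}"
        using assms by (auto simp: k_partition_1_iff simp del: One_nat_def)
      then have "\<exists>g\<in>G. transversal {B} (g ` {a})"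
        using ut[unfolded ut_def, rule_format, of "{a}" B "{B}"] a B by simp
      then show "\<exists>g\<in>G. g a \<in> B"
        by (simp only: transversal_singleton_iff)
    qed
  next
    assume meets: "\<forall>a\<in>\<Omega>. \<forall>B. B \<subseteq> \<Omega> \<and> card B = l \<longrightarrow> (\<exists>g\<in>G. g a \<in> B)"
    show "ut \<Omega> G 1 l"
      unfolding ut_def
    proof (intro allI impI)
      fix A B P
      assume h: "A \<subseteq> \<Omega> \<and> card A = 1 \<and> B \<subseteq> \<Omega> \<and> card B = l \<and> k_partition 1 B P"
      then obtain a where A: "A = {a}" "a \<in> \<Omega>"
        by (auto simp: card_1_singleton_iff)
      have "P = {B}"
        using h by (simp only: k_partition_1_iff)
      moreover obtain g where "g \<in> G" "g a \<in> B"
        using meets A(2) h by blast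
      ultimately have "transversal P (g ` A)"
        by (simp only: A(1) transversal_singleton_iff)
      with \<open>g \<in> G\<close> show "\<exists>g\<in>G. transversal P (g ` A)"
        by - (rule rev_bexI)
    qed
  qed
  also have "\<dots> \<longleftrightarrow> (\<forall>X\<in>perm_orbits \<Omega> G. \<forall>B. B \<subseteq> \<Omega> \<and> card B = l \<longrightarrow> B \<inter> X \<noteq> {})"
  proof -
    have "B \<inter> (\<lambda>g. g a) ` G \<noteq> {} \<longleftrightarrow> (\<exists>g\<in>G. g a \<in> B)" for a B
      by auto
    then show ?thesis
      by (simp only: perm_orbits_eq ball_simps)
  qed
  finally show ?thesis .
qed

text \<open>
  A subset of size \<open>l\<close> that misses \<open>X\<close> is an \<open>l\<close>-subset of the complement of \<open>X\<close>, and one exists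
  exactly when that complement is large enough.
\<close>

lemma all_subsets_meet_iff:
  assumes "finite S" "X \<subseteq> S"
  shows "(\<forall>B. B \<subseteq> S \<and> card B = l \<longrightarrow> B \<inter> X \<noteq> {}) \<longleftrightarrow> card S - card X < l"
proof -
  have card: "card (S - X) = card S - card X"
    using assms by (simp add: card_Diff_subset finite_subset)
  show ?thesis
  proof
    assume meets: "\<forall>B. B \<subseteq> S \<and> card B = l \<longrightarrow> B \<inter> X \<noteq> {}"
    show "card S - card X < l"
    proof (rule ccontr)
      assume "\<not> card S - card X < l"
      then obtain B where "B \<subseteq> S - X" "card B = l"
        using obtain_subset_with_card_n[of l "S - X"] card by auto
      with meets show False by blast
    qed
  next
    assume less: "card S - card X < l"
    show "\<forall>B. B \<subseteq> S \<and> card B = l \<longrightarrow> B \<inter> X \<noteq> {}"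
    proof (intro allI impI notI)
      fix B assume "B \<subseteq> S \<and> card B = l" "B \<inter> X = {}"
      then have "l \<le> card (S - X)"
        using assms card_mono[of "S - X" B] by auto
      with less card show False by simp
    qed
  qed
qed

lemma ut_1_iff_orbit_sizes:
  assumes "finite \<Omega>" "subgroup G (BijGroup \<Omega>)" "1 \<le> l" "l \<le> card \<Omega>"
  shows "ut \<Omega> G 1 l \<longleftrightarrow> (\<forall>X\<in>perm_orbits \<Omega> G. card \<Omega> - l + 1 \<le> card X)"
proof -
  have "ut \<Omega> G 1 l \<longleftrightarrow> (\<forall>X\<in>perm_orbits \<Omega> G. card \<Omega> - card X < l)"
    using assms perm_orbit_subset[OF assms(2)]
    by (auto simp: ut_1_iff_meets_orbits all_subsets_meet_iff simp del: One_nat_def)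
  also have "\<dots> \<longleftrightarrow> (\<forall>X\<in>perm_orbits \<Omega> G. card \<Omega> - l + 1 \<le> card X)"
  proof (rule ball_cong[OF refl])
    fix X assume "X \<in> perm_orbits \<Omega> G"
    then have "card X \<le> card \<Omega>"
      using assms perm_orbit_subset by (blast intro: card_mono)
    then show "card \<Omega> - card X < l \<longleftrightarrow> card \<Omega> - l + 1 \<le> card X"
      using assms by linarith
  qed
  finally show ?thesis .
qed

text \<open>
  Two candidates for the threshold are both admissible values of \<open>l\<close>, so testing each against the
  other gives equality.
\<close>

lemma threshold_eqI:
  assumes "k \<le> t" "t \<le> card \<Omega>"
    and "\<And>l. k \<le> l \<Longrightarrow> l \<le> card \<Omega> \<Longrightarrow> ut \<Omega> G k l \<longleftrightarrow> t \<le> l"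
  shows "threshold \<Omega> G k = t"
  unfolding threshold_def
proof (rule the_equality)
  fix s
  assume s: "k \<le> s \<and> s \<le> card \<Omega> \<and> (\<forall>l. k \<le> l \<and> l \<le> card \<Omega> \<longrightarrow> (ut \<Omega> G k l \<longleftrightarrow> s \<le> l))"
  then have "ut \<Omega> G k s" "ut \<Omega> G k t \<longleftrightarrow> s \<le> t" "ut \<Omega> G k t"
    using assms by auto
  then show "s = t"
    using s assms(3)[of s] by auto
qed (use assms in blast)

theorem proposition3p1:
  fixes \<Omega> :: "'a set" and G :: "('a \<Rightarrow> 'a) set" and n d :: nat
  assumes "finite \<Omega>" and "card \<Omega> = n" and "1 \<le> n"
    and "subgroup G (BijGroup \<Omega>)"
    and "d = Min (card ` perm_orbits \<Omega> G)"
  shows "(\<forall>l. 1 \<le> l \<and> l \<le> n \<longrightarrow> (ut \<Omega> G 1 l \<longleftrightarrow> (\<forall>X\<in>perm_orbits \<Omega> G. n - l + 1 \<le> card X)))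
    \<and> threshold \<Omega> G 1 = n - d + 1"
proof
  show sizes: "\<forall>l. 1 \<le> l \<and> l \<le> n \<longrightarrow>
      (ut \<Omega> G 1 l \<longleftrightarrow> (\<forall>X\<in>perm_orbits \<Omega> G. n - l + 1 \<le> card X))"
    using ut_1_iff_orbit_sizes assms by blast
  have fin: "finite (perm_orbits \<Omega> G)"
    using assms by (simp add: perm_orbits_eq)
  have ne: "perm_orbits \<Omega> G \<noteq> {}"
    using assms by (auto simp: perm_orbits_eq)
  have "d \<in> card ` perm_orbits \<Omega> G"
    using assms(5) fin ne by simp
  then obtain X where X: "X \<in> perm_orbits \<Omega> G" "d = card X"
    by blast
  have "X \<subseteq> \<Omega>" "X \<noteq> {}"
    using perm_orbit_subset perm_orbit_nonempty assms(4) X(1) by blast+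
  then have d: "1 \<le> d" "d \<le> n"
    using X(2) assms by (auto simp: card_gt_0_iff Suc_le_eq finite_subset intro: card_mono)
  show "threshold \<Omega> G 1 = n - d + 1"
  proof (rule threshold_eqI)
    fix l assume l: "1 \<le> l" "l \<le> card \<Omega>"
    have "(\<forall>X\<in>perm_orbits \<Omega> G. n - l + 1 \<le> card X) \<longleftrightarrow> n - l + 1 \<le> d"
      using assms(5) fin ne by simp
    then show "ut \<Omega> G 1 l \<longleftrightarrow> n - d + 1 \<le> l"
      using sizes l d assms(2) by (simp del: One_nat_def) linarith
  qed (use d assms in auto)
qed

end
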